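(* Let $m,n\in\mathbb{N}$. Let $\mathcal{Z}$ be a zero-set and let $\mathcal{F}$ be a minimal family of double stars such that $\mathcal{Z}$ and $\mathcal{Y}_{\mathcal{F}}$ are both subsets of $R_{n,m}$ and are duals of each other (with respect to $m,n$). Then $$\gamma(\mathcal{Z},m,n)+\mathrm{ex}(m,n,\mathcal{F})=mn.$$
   Context: Notation: $\mathbb{Z}_+=\{0,1,2,\dots\}$, $\mathbb{N}=\{1,2,\dots\}$, $[0,c]=\{0,\dots,c\}$, $R_{a,b}=[0,a-1]\times[0,b-1]$. A zero-set (or Young diagram) is a downward-closed subset of $\mathbb{Z}_+^2$. Young domination: the graph $K_m\Box K_n$ is represented on the vertex set $R_{n,m}=[0,n-1]\times[0,m-1]$, two vertices being adjacent iff they differ in exactly one coordinate. For $v=(j,i)\in R_{n,m}$, $\mathcal{N}^r(v)$ is the set of all $(j',i)\in R_{n,m}$ with $j'\ne j$ and $\mathcal{N}^c(v)$ the set of all $(j,i')\in R_{n,m}$ with $i'\neq i$. For a zero-set $\mathcal{Z}$, $\mathcal{T}(A)=A\cup\{v\in R_{n,m}\setminus A\colon (|\mathcal{N}^r(v)\cap A|,|\mathcal{N}^c(v)\cap A|)\notin\mathcal{Z}\}$ and $\gamma(\mathcal{Z},m,n)=\min\{|A|\colon A\subseteq R_{n,m},\ \mathcal{T}(A)=R_{n,m}\}$. Corners and duality: a convex corner of a Young diagram $\mathcal{Y}$ is a maximal point of $\mathcal{Y}$ in the coordinatewise partial order; a concave corner is a minimal point of $\mathbb{Z}_+^2\setminus\mathcal{Y}$;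 $\mathcal{I}_{\mathcal{Y}}$ is the set of concave corners. For a Young diagram $\mathcal{Y}\subseteq R_{n,m}$, its dual is the unique Young diagram $\check{\mathcal{Y}}\subseteq R_{n,m}$ whose set of convex corners is $\{(n-a-1,m-b-1)\colon (a,b)\in\mathcal{I}_{\mathcal{Y}},\ 0\le a\le n-1,\ 0\le b\le m-1\}$. Double stars: for integers $p,q\ge0$, the double star $S_{p,q}$ is obtained from disjoint $K_{1,p}$ and $K_{1,q}$ by adding an edge between the center $u$ of $K_{1,p}$ (a vertex of degree $p$) and the center $v$ of $K_{1,q}$ (a vertex of degree $q$); it is equipped with the bipartition $(X_{p,q},Y_{p,q})$ with $u\in X_{p,q}$, $v\in Y_{p,q}$. A family $\mathcal{F}$ of double stars is minimal if for all distinct $(p,q),(p',q')$ with $S_{p,q},S_{p',q'}\in\mathcal{F}$ it is not true that $(p,q)\le(p',q')$ coordinatewise. To a minimal family $\mathcal{F}$ one associates the Young diagram $\mathcal{Y}_{\mathcal{F}}$ whose concave corners are exactly the points $(p,q)$ with $S_{p,q}\in\mathcal{F}$. Bipartite Turán number: $\mathrm{ex}(m,n,\mathcal{F})$ is the maximum number of edges in a bipartite graph $G$ with bipartition $(X,Y)$, $|X|=m$, $|Y|=n$, that contains no $S_{p,q}\in\mathcal{F}$ as a (not necessarily induced) subgraph respecting the bipartitions (i.e. with $X_{p,q}$ inside $X$ and $Y_{p,q}$ inside $Y$). *)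

theory Defs
  imports Main "HOL-Library.Product_Order"
begin

text \<open>On pairs, \<open>\<le>\<close> is the coordinatewise order (from \<^theory>\<open>HOL-Library.Product_Order\<close>).\<close>

definition rect :: "nat \<Rightarrow> nat \<Rightarrow> (nat \<times> nat) set" where
  "rect a b = {..<a} \<times> {..<b}"

definition young_diagram :: "(nat \<times> nat) set \<Rightarrow> bool" where
  "young_diagram Y \<longleftrightarrow> (\<forall>x y. y \<in> Y \<and> x \<le> y \<longrightarrow> x \<in> Y)"

definition convex_corners :: "(nat \<times> nat) set \<Rightarrow> (nat \<times> nat) set" where
  "convex_corners Y = {x \<in> Y. \<forall>y\<in>Y. x \<le> y \<longrightarrow> y = x}"

definition concave_corners :: "(nat \<times> nat) set \<Rightarrow> (nat \<times> nat) set" where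
  "concave_corners Y = {x. x \<notin> Y \<and> (\<forall>y. y \<notin> Y \<and> y \<le> x \<longrightarrow> y = x)}"

definition dual_corners :: "nat \<Rightarrow> nat \<Rightarrow> (nat \<times> nat) set \<Rightarrow> (nat \<times> nat) set" where
  "dual_corners n m Y =
     {(n - a - 1, m - b - 1) | a b. (a, b) \<in> concave_corners Y \<and> a \<le> n - 1 \<and> b \<le> m - 1}"

text \<open>Meaningful for \<open>n, m \<ge> 1\<close>; see \<open>dual_ex1\<close> below for existence and uniqueness.\<close>

definition dual :: "nat \<Rightarrow> nat \<Rightarrow> (nat \<times> nat) set \<Rightarrow> (nat \<times> nat) set" where
  "dual n m Y =
     (THE Y'. young_diagram Y' \<and> Y' \<subseteq> rect n m \<and> convex_corners Y' = dual_corners n m Y)"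


subsection \<open>Young domination\<close>

text \<open>A vertex is \<open>v = (j, i)\<close> with column index \<open>j < n\<close> and row index \<open>i < m\<close>.\<close>

definition row_nbrs :: "nat \<Rightarrow> nat \<Rightarrow> nat \<times> nat \<Rightarrow> (nat \<times> nat) set" where
  "row_nbrs m n v = {w \<in> rect n m. snd w = snd v \<and> fst w \<noteq> fst v}"

definition col_nbrs :: "nat \<Rightarrow> nat \<Rightarrow> nat \<times> nat \<Rightarrow> (nat \<times> nat) set" where
  "col_nbrs m n v = {w \<in> rect n m. fst w = fst v \<and> snd w \<noteq> snd v}"

definition growth :: "(nat \<times> nat) set \<Rightarrow> nat \<Rightarrow> nat \<Rightarrow> (nat \<times> nat) set \<Rightarrow> (nat \<times> nat) set" where
  "growth Z m n A =
     A \<union> {v \<in> rect n m - A. (card (row_nbrs m n v \<inter> A), card (col_nbrs m n v \<inter> A)) \<notin> Z}"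

definition young_dom_number :: "(nat \<times> nat) set \<Rightarrow> nat \<Rightarrow> nat \<Rightarrow> nat" where
  "young_dom_number Z m n = Min {card A | A. A \<subseteq> rect n m \<and> growth Z m n A = rect n m}"


subsection \<open>Bipartite graphs and double stars\<close>

text \<open>
  A bipartite graph with an ordered bipartition.  The two parts are understood as disjoint (they
  may even have different types); a pair \<open>(x, y)\<close> stands for the undirected edge between
  \<open>x\<close> in the left part and \<open>y\<close> in the right part.
\<close>

record ('a, 'b) bigraph =
  left_part :: "'a set"
  right_part :: "'b set"
  edges :: "('a \<times> 'b) set"

definition bipartite_graph :: "('a, 'b) bigraph \<Rightarrow> bool" where
  "bipartite_graph G \<longleftrightarrow>
     finite (left_part G) \<and> finite (right_part G) \<and> edges G \<subseteq> left_part G \<times> right_part G"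

text \<open>\<open>H\<close> is, up to isomorphism, a (not necessarily induced) subgraph of \<open>G\<close>
  respecting the bipartitions.\<close>

definition contains_bigraph :: "('a, 'b) bigraph \<Rightarrow> ('c, 'd) bigraph \<Rightarrow> bool" where
  "contains_bigraph G H \<longleftrightarrow>
     (\<exists>f g. inj_on f (left_part H) \<and> f ` left_part H \<subseteq> left_part G \<and>
            inj_on g (right_part H) \<and> g ` right_part H \<subseteq> right_part G \<and>
            (\<forall>(x, y) \<in> edges H. (f x, g y) \<in> edges G))"

text \<open>
  The double star \<open>S\<^sub>p\<^sub>,\<^sub>q\<close>.  The centre \<open>u\<close> is the left vertex \<open>0\<close> and the centre \<open>v\<close> is
  the right vertex \<open>0\<close>.  The \<open>p\<close> leaves at \<open>u\<close> are the right vertices \<open>1, \<dots>, p\<close>, the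
  \<open>q\<close> leaves at \<open>v\<close> are the left vertices \<open>1, \<dots>, q\<close>.
\<close>

definition double_star :: "nat \<Rightarrow> nat \<Rightarrow> (nat, nat) bigraph" where
  "double_star p q =
     \<lparr>left_part = {0..q}, right_part = {0..p},
      edges = {(0, 0)} \<union> {(0, y) | y. y \<in> {1..p}} \<union> {(x, 0) | x. x \<in> {1..q}}\<rparr>"

definition minimal_family :: "(nat, nat) bigraph set \<Rightarrow> bool" where
  "minimal_family F \<longleftrightarrow>
     F \<subseteq> {double_star p q | p q. True} \<and>
     (\<forall>p q p' q'. double_star p q \<in> F \<and> double_star p' q' \<in> F \<and> (p, q) \<noteq> (p', q')
        \<longrightarrow> \<not> (p, q) \<le> (p', q'))"

text \<open>See \<open>family_diagram_ex1\<close> below for existence and uniqueness.\<close>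

definition family_diagram :: "(nat, nat) bigraph set \<Rightarrow> (nat \<times> nat) set" where
  "family_diagram F =
     (THE Y. young_diagram Y \<and> concave_corners Y = {(p, q). double_star p q \<in> F})"

text \<open>Taking the vertices from \<^typ>\<open>nat\<close> is no restriction, since all graphs are finite.\<close>

definition bip_turan :: "nat \<Rightarrow> nat \<Rightarrow> (nat, nat) bigraph set \<Rightarrow> nat" where
  "bip_turan m n F =
     Max {card (edges G) | G :: (nat, nat) bigraph.
            bipartite_graph G \<and> card (left_part G) = m \<and> card (right_part G) = n \<and>
            (\<forall>S\<in>F. \<not> contains_bigraph G S)}"


subsection \<open>Well-definedness\<close>

lemma finite_young_convex:
  assumes "young_diagram Y" "finite Y"
  shows "Y = {z. \<exists>c\<in>convex_corners Y. z \<le> c}"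
proof -
  have "\<exists>c\<in>convex_corners Y. z \<le> c" if "z \<in> Y" for z
    using finite_has_maximal2[OF assms(2) that] unfolding convex_corners_def by blast
  moreover have "z \<in> Y" if "c \<in> convex_corners Y" "z \<le> c" for z c
    using that assms(1) unfolding young_diagram_def convex_corners_def by blast
  ultimately show ?thesis by blast
qed

lemma young_concave:
  assumes "young_diagram Y"
  shows "- Y = {z. \<exists>c\<in>concave_corners Y. c \<le> z}"
proof -
  have "\<exists>c\<in>concave_corners Y. c \<le> z" if "z \<notin> Y" for z
  proof -
    have fin: "finite ({..fst z} \<times> {..snd z} - Y)" by simp
    have mem: "z \<in> {..fst z} \<times> {..snd z} - Y" using that by (cases z) auto
    obtain c where c: "c \<in> {..fst z} \<times> {..snd z} - Y" "c \<le> z"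
        "\<forall>b\<in>{..fst z} \<times> {..snd z} - Y. b \<le> c \<longrightarrow> c = b"
      using finite_has_minimal2[OF fin mem] by metis
    have "c \<in> concave_corners Y"
      unfolding concave_corners_def
    proof (intro CollectI conjI allI impI)
      show "c \<notin> Y" using c(1) by blast
      fix y assume y: "y \<notin> Y \<and> y \<le> c"
      then have "y \<le> z" using c(2) by (meson order_trans)
      then have "y \<in> {..fst z} \<times> {..snd z} - Y"
        using y by (cases y) (auto simp: less_eq_prod_def)
      then show "y = c" using c(3) y by metis
    qed
    then show ?thesis using c(2) by blast
  qed
  moreover have "z \<notin> Y" if "c \<in> concave_corners Y" "c \<le> z" for z c
    using that assms unfolding young_diagram_def concave_corners_def by blast
  ultimately show ?thesis by blast
qed

lemma dual_ex1:
  assumes "1 \<le> n" "1 \<le> m"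
  shows "\<exists>!Y'. young_diagram Y' \<and> Y' \<subseteq> rect n m \<and> convex_corners Y' = dual_corners n m Y"
proof (rule ex1I)
  let ?C = "dual_corners n m Y"
  let ?D = "{z. \<exists>c\<in>?C. z \<le> c}"
  have anti: "c = d" if "c \<in> ?C" "d \<in> ?C" "c \<le> d" for c d
  proof -
    obtain a b where 1: "c = (n - a - 1, m - b - 1)" "(a, b) \<in> concave_corners Y"
        "a \<le> n - 1" "b \<le> m - 1" using \<open>c \<in> ?C\<close> unfolding dual_corners_def by blast
    obtain a' b' where 2: "d = (n - a' - 1, m - b' - 1)" "(a', b') \<in> concave_corners Y"
        "a' \<le> n - 1" "b' \<le> m - 1" using \<open>d \<in> ?C\<close> unfolding dual_corners_def by blast
    have "(a', b') \<le> (a, b)" using \<open>c \<le> d\<close> 1 2 assms by (auto simp: less_eq_prod_def)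
    then have "(a', b') = (a, b)" using 1(2) 2(2) unfolding concave_corners_def by blast
    then show ?thesis using 1 2 by simp
  qed
  have "young_diagram ?D" unfolding young_diagram_def by (blast intro: order_trans)
  moreover have "?D \<subseteq> rect n m"
    using assms by (auto simp: dual_corners_def rect_def less_eq_prod_def)
  moreover have "convex_corners ?D = ?C"
  proof
    show "convex_corners ?D \<subseteq> ?C"
    proof
      fix z assume z: "z \<in> convex_corners ?D"
      then obtain c where "c \<in> ?C" "z \<le> c" unfolding convex_corners_def by blast
      moreover have "c \<in> ?D" using \<open>c \<in> ?C\<close> by blast
      ultimately show "z \<in> ?C" using z unfolding convex_corners_def by blast
    qed
    show "?C \<subseteq> convex_corners ?D"
    proof
      fix c assume c: "c \<in> ?C"
      have "y = c" if "d \<in> ?C" "y \<le> d" "c \<le> y" for y d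
        using anti[OF c that(1)] that order_antisym order_trans by metis
      then show "c \<in> convex_corners ?D" using c unfolding convex_corners_def by blast
    qed
  qed
  ultimately show "young_diagram ?D \<and> ?D \<subseteq> rect n m \<and> convex_corners ?D = ?C" by blast
  fix Y' assume Y': "young_diagram Y' \<and> Y' \<subseteq> rect n m \<and> convex_corners Y' = ?C"
  have "finite (rect n m)" by (simp add: rect_def)
  with Y' have "finite Y'" using finite_subset by blast
  then show "Y' = ?D" using finite_young_convex[of Y'] Y' by simp
qed

lemma family_diagram_ex1:
  assumes "minimal_family F"
  shows "\<exists>!Y. young_diagram Y \<and> concave_corners Y = {(p, q). double_star p q \<in> F}"
proof (rule ex1I)
  let ?C = "{(p, q). double_star p q \<in> F}"
  let ?D = "- {z. \<exists>c\<in>?C. c \<le> z}"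
  have anti: "c = d" if "c \<in> ?C" "d \<in> ?C" "c \<le> d" for c d
  proof (rule ccontr)
    assume "c \<noteq> d"
    obtain p q p' q' where pq: "c = (p, q)" "d = (p', q')" by (cases c, cases d)
    have "double_star p q \<in> F" "double_star p' q' \<in> F" "(p, q) \<noteq> (p', q')" "(p, q) \<le> (p', q')"
      using that \<open>c \<noteq> d\<close> unfolding pq by simp_all
    then show False
      using conjunct2[OF assms[unfolded minimal_family_def], rule_format, of p q p' q'] by simp
  qed
  have "young_diagram ?D" unfolding young_diagram_def by (blast intro: order_trans)
  moreover have "concave_corners ?D = ?C"
  proof
    show "concave_corners ?D \<subseteq> ?C"
    proof
      fix z assume z: "z \<in> concave_corners ?D"
      then obtain c where c: "c \<in> ?C" "c \<le> z" unfolding concave_corners_def by blast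
      then have "c \<notin> ?D" by blast
      then have "c = z" using z c(2) unfolding concave_corners_def by blast
      then show "z \<in> ?C" using c(1) by simp
    qed
    show "?C \<subseteq> concave_corners ?D"
    proof
      fix c assume c: "c \<in> ?C"
      have "y = c" if "d \<in> ?C" "d \<le> y" "y \<le> c" for y d
        using anti[OF that(1) c] that order_antisym order_trans by metis
      then show "c \<in> concave_corners ?D" using c unfolding concave_corners_def by blast
    qed
  qed
  ultimately show "young_diagram ?D \<and> concave_corners ?D = ?C" by blast
  fix Y assume Y: "young_diagram Y \<and> concave_corners Y = ?C"
  then have "- Y = {z. \<exists>c\<in>?C. c \<le> z}" using young_concave[of Y] by simp
  then show "Y = ?D" using double_complement[of Y] by simp
qed

end

theory Submission
  imports Defs
begin

text \<open>
  Read the complement of a set \<open>A\<close> of vertices as the edge set of a bipartite graph \<open>G\<close>, the vertex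
  \<open>(j, i)\<close> being the edge that joins \<open>i\<close> in the left part to \<open>j\<close> in the right part.  An edge whose
  ends have degrees \<open>d\<close> and \<open>e\<close> has \<open>n - d\<close> row neighbours and \<open>m - e\<close> column neighbours in \<open>A\<close>.
  It is the central edge of an \<open>S\<^sub>p\<^sub>,\<^sub>q\<close> in \<open>G\<close> iff \<open>(p, q) \<le> (d - 1, e - 1)\<close>, so no member of the
  family is centred at it iff \<open>(d - 1, e - 1)\<close> lies in the diagram of the family.  Duality is
  reflection of the complement in the rectangle, hence this happens iff \<open>(n - d, m - e)\<close> is outside the
  zero-set.  So \<open>A\<close> is dominating iff \<open>G\<close> avoids the family, and complements of minimum dominating
  sets are the extremal graphs.
\<close>

text \<open>The map \<open>(a, b)\<close> to \<open>(n - 1 - a, m - 1 - b)\<close> reverses the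
  order on the rectangle. So lying below a corner of the dual is the mirror image of lying above a
  concave corner of \<open>Y\<close>, which means being outside \<open>Y\<close>.\<close>

lemma mem_dual_iff:
  assumes "young_diagram Y" "a < n" "b < m"
  shows "(n - 1 - a, m - 1 - b) \<in> dual n m Y \<longleftrightarrow> (a, b) \<notin> Y"
proof -
  let ?D = "dual n m Y"
  have nm: "1 \<le> n" "1 \<le> m" using assms by auto
  have D: "young_diagram ?D \<and> ?D \<subseteq> rect n m \<and> convex_corners ?D = dual_corners n m Y"
    unfolding dual_def by (rule theI'[OF dual_ex1[OF nm]])
  have "finite (rect n m)" by (simp add: rect_def)
  then have "finite ?D" using D finite_subset by blast
  then have mem: "z \<in> ?D \<longleftrightarrow> (\<exists>c\<in>dual_corners n m Y. z \<le> c)" for z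
    using finite_young_convex[of ?D] D by auto
  have notin: "(a, b) \<notin> Y \<longleftrightarrow> (\<exists>c\<in>concave_corners Y. c \<le> (a, b))"
    using young_concave[OF assms(1)] by blast
  show ?thesis
  proof
    assume "(n - 1 - a, m - 1 - b) \<in> ?D"
    then obtain a' b' where "(a', b') \<in> concave_corners Y" "a' \<le> n - 1" "b' \<le> m - 1"
      "(n - 1 - a, m - 1 - b) \<le> (n - a' - 1, m - b' - 1)"
      unfolding mem dual_corners_def by blast
    moreover from this have "(a', b') \<le> (a, b)" using assms(2,3) by auto
    ultimately show "(a, b) \<notin> Y" using notin by blast
  next
    assume "(a, b) \<notin> Y"
    then obtain a' b' where c: "(a', b') \<in> concave_corners Y" "a' \<le> a" "b' \<le> b"
      using notin by auto
    \<comment> \<open>The dual ignores concave corners outside the rectangle. This one lies below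
      \<open>(a, b)\<close>, hence inside it, and is kept.\<close>
    then have "(n - a' - 1, m - b' - 1) \<in> dual_corners n m Y"
      unfolding dual_corners_def using assms(2,3) by force
    moreover have "(n - 1 - a, m - 1 - b) \<le> (n - a' - 1, m - b' - 1)" using c by auto
    ultimately show "(n - 1 - a, m - 1 - b) \<in> ?D" unfolding mem by blast
  qed
qed

text \<open>Embeds one side of a double star: \<open>B\<close> is the neighbourhood of one centre,
  \<open>b\<close> is the opposite centre, and the strict bound leaves \<open>k\<close> further
  elements of \<open>B\<close> for the leaves.\<close>

lemma ex_inj_on_fixing_zero:
  assumes "finite B" "b \<in> B" "k < card B"
  shows "\<exists>f. inj_on f {0..k} \<and> f ` {0..k} \<subseteq> B \<and> f 0 = b"
proof -
  have "card {1..k} \<le> card (B - {b})" using assms by simp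
  then obtain h where h: "h ` {1..k} \<subseteq> B - {b}" "inj_on h {1..k}"
    using card_le_inj[of "{1..k}" "B - {b}"] assms(1) by auto
  have "{0..k} = insert 0 {1..k}" by auto
  moreover have "(h(0 := b)) ` {1..k} = h ` {1..k}" by (rule image_cong) auto
  moreover have "inj_on (h(0 := b)) {1..k}"
    using h(2) by (subst inj_on_cong[of _ _ h]) auto
  ultimately have "inj_on (h(0 := b)) {0..k} \<and> (h(0 := b)) ` {0..k} \<subseteq> B \<and> (h(0 := b)) 0 = b"
    using h(1) assms(2) by auto
  then show ?thesis by blast
qed

text \<open>The leaves at the two centres lie in opposite parts, so they can be chosen independently
  without collision. The inequalities are strict because the central edge uses up one neighbour at
  each end.\<close>

lemma contains_double_star_iff:
  assumes "bipartite_graph G"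
  shows "contains_bigraph G (double_star p q) \<longleftrightarrow>
    (\<exists>(x, y)\<in>edges G. p < card (edges G `` {x}) \<and> q < card ((edges G)\<inverse> `` {y}))"
proof
  have fin: "finite (edges G `` {x})" "finite ((edges G)\<inverse> `` {y})" for x y
    using assms finite_subset[of "edges G `` {x}" "right_part G"]
      finite_subset[of "(edges G)\<inverse> `` {y}" "left_part G"]
    unfolding bipartite_graph_def by blast+
  {
    assume "contains_bigraph G (double_star p q)"
    then obtain f g where inj: "inj_on f {0..q}" "inj_on g {0..p}"
      and E: "\<forall>(x, y)\<in>edges (double_star p q). (f x, g y) \<in> edges G"
      unfolding contains_bigraph_def by (auto simp: double_star_def)
    \<comment> \<open>The value \<open>y = 0\<close> is the central edge, so the image of the left
      centre has \<open>p + 1\<close> distinct neighbours.\<close>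
    have *: "(f 0, g y) \<in> edges G" if "y \<le> p" for y
      using E that by (cases "y = 0") (auto simp: double_star_def)
    have **: "(f x, g 0) \<in> edges G" if "x \<le> q" for x
      using E that by (cases "x = 0") (auto simp: double_star_def)
    have "card {0..p} \<le> card (edges G `` {f 0})"
      using * by (intro card_inj_on_le[OF inj(2) _ fin(1)]) auto
    moreover have "card {0..q} \<le> card ((edges G)\<inverse> `` {g 0})"
      using ** by (intro card_inj_on_le[OF inj(1) _ fin(2)]) auto
    ultimately show "\<exists>(x, y)\<in>edges G. p < card (edges G `` {x}) \<and> q < card ((edges G)\<inverse> `` {y})"
      using *[of 0] by (intro bexI[of _ "(f 0, g 0)"]) auto
  }
  assume "\<exists>(x, y)\<in>edges G. p < card (edges G `` {x}) \<and> q < card ((edges G)\<inverse> `` {y})"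
  then obtain x y where xy: "(x, y) \<in> edges G" "p < card (edges G `` {x})"
    "q < card ((edges G)\<inverse> `` {y})" by blast
  obtain g where g: "inj_on g {0..p}" "g ` {0..p} \<subseteq> edges G `` {x}" "g 0 = y"
    using ex_inj_on_fixing_zero[OF fin(1) _ xy(2), of y] xy(1) by blast
  obtain f where f: "inj_on f {0..q}" "f ` {0..q} \<subseteq> (edges G)\<inverse> `` {y}" "f 0 = x"
    using ex_inj_on_fixing_zero[OF fin(2) _ xy(3), of x] xy(1) by blast
  have sub: "edges G `` {x} \<subseteq> right_part G" "(edges G)\<inverse> `` {y} \<subseteq> left_part G"
    using assms unfolding bipartite_graph_def by blast+
  have ne: "(x, g k) \<in> edges G" if "k \<le> p" for k
    using g(2) that by (auto simp: image_subset_iff)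
  have nf: "(f k, y) \<in> edges G" if "k \<le> q" for k
    using f(2) that by (auto simp: image_subset_iff)
  have "\<forall>(u, v)\<in>edges (double_star p q). (f u, g v) \<in> edges G"
    using f(3) g(3) xy(1) ne nf by (auto simp: double_star_def)
  moreover have "f ` {0..q} \<subseteq> left_part G" "g ` {0..p} \<subseteq> right_part G"
    using f(2) g(2) sub by blast+
  ultimately show "contains_bigraph G (double_star p q)"
    unfolding contains_bigraph_def
    by (intro exI[of _ f] exI[of _ g]) (use f(1) g(1) in \<open>simp add: double_star_def\<close>)
qed

lemma family_diagram_props:
  assumes "minimal_family F"
  shows "young_diagram (family_diagram F)"
    and "concave_corners (family_diagram F) = {(p, q). double_star p q \<in> F}"
  using theI'[OF family_diagram_ex1[OF assms]] unfolding family_diagram_def by simp_all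

lemma avoids_family_iff:
  assumes "minimal_family F" "bipartite_graph G"
  shows "(\<forall>S\<in>F. \<not> contains_bigraph G S) \<longleftrightarrow>
    (\<forall>(x, y)\<in>edges G.
      (card (edges G `` {x}) - 1, card ((edges G)\<inverse> `` {y}) - 1) \<in> family_diagram F)"
proof -
  \<comment> \<open>The complement of a diagram is the upward closure of its concave corners, here
    the index pairs of the family.\<close>
  have nY: "(d, e) \<notin> family_diagram F \<longleftrightarrow> (\<exists>p q. double_star p q \<in> F \<and> p \<le> d \<and> q \<le> e)" for d e
  proof -
    have "(d, e) \<in> - family_diagram F \<longleftrightarrow> (\<exists>p q. double_star p q \<in> F \<and> p \<le> d \<and> q \<le> e)"
      unfolding young_concave[OF family_diagram_props(1)[OF assms(1)]]
        family_diagram_props(2)[OF assms(1)] by auto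
    then show ?thesis by simp
  qed
  have fin: "finite (edges G `` {x})" "finite ((edges G)\<inverse> `` {y})" for x y
    using assms(2) finite_subset[of "edges G `` {x}" "right_part G"]
      finite_subset[of "(edges G)\<inverse> `` {y}" "left_part G"]
    unfolding bipartite_graph_def by blast+
  \<comment> \<open>Both ends of an edge have positive degree, so \<open>p \<le> d - 1\<close> and
    \<open>p < d\<close> agree despite truncated subtraction.\<close>
  have "0 < card (edges G `` {x})" "0 < card ((edges G)\<inverse> `` {y})" if "(x, y) \<in> edges G" for x y
    using that fin by (auto simp: card_gt_0_iff)
  then have "p \<le> card (edges G `` {x}) - 1 \<and> q \<le> card ((edges G)\<inverse> `` {y}) - 1 \<longleftrightarrow>
      p < card (edges G `` {x}) \<and> q < card ((edges G)\<inverse> `` {y})"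
    if "(x, y) \<in> edges G" for x y p q
    using that by (metis Suc_pred' less_Suc_eq_le)
  then have nYG: "(card (edges G `` {x}) - 1, card ((edges G)\<inverse> `` {y}) - 1) \<notin> family_diagram F \<longleftrightarrow>
      (\<exists>p q. double_star p q \<in> F \<and> p < card (edges G `` {x}) \<and> q < card ((edges G)\<inverse> `` {y}))"
    if "(x, y) \<in> edges G" for x y
    using that nY by blast
  have "(\<exists>S\<in>F. contains_bigraph G S) \<longleftrightarrow>
      (\<exists>p q. double_star p q \<in> F \<and> contains_bigraph G (double_star p q))"
    using assms(1) unfolding minimal_family_def by blast
  also have "\<dots> \<longleftrightarrow> (\<exists>(x, y)\<in>edges G.
      (card (edges G `` {x}) - 1, card ((edges G)\<inverse> `` {y}) - 1) \<notin> family_diagram F)"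
    unfolding contains_double_star_iff[OF assms(2)] using nYG by blast
  finally show ?thesis by blast
qed

text \<open>The labellings \<open>f\<close> and \<open>g\<close> are arbitrary bijections so that
  the correspondence can be read both ways: from a set of vertices to a graph, and from a graph on
  any vertex sets back to a set of vertices.\<close>

lemma dominating_iff_avoids_family:
  assumes dual: "Z = dual n m (family_diagram F)" and F: "minimal_family F"
    and f: "bij_betw f {..<m} (left_part G)" and g: "bij_betw g {..<n} (right_part G)"
    and A: "A \<subseteq> rect n m" and E: "edges G = (\<lambda>(j, i). (f i, g j)) ` (rect n m - A)"
  shows "bipartite_graph G"
    and "card A + card (edges G) = m * n"
    and "growth Z m n A = rect n m \<longleftrightarrow> (\<forall>S\<in>F. \<not> contains_bigraph G S)"
proof -
  have fi: "f i = f i' \<longleftrightarrow> i = i'" if "i < m" "i' < m" for i i'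
    using f that unfolding bij_betw_def inj_on_def by auto
  have gi: "g j = g j' \<longleftrightarrow> j = j'" if "j < n" "j' < n" for j j'
    using g that unfolding bij_betw_def inj_on_def by auto
  have fin: "finite (rect n m)" and cardR: "card (rect n m) = m * n"
    by (simp_all add: rect_def)
  have "finite (left_part G)" "finite (right_part G)"
    using bij_betw_finite[OF f] bij_betw_finite[OF g] by auto
  moreover have "f i \<in> left_part G" if "i < m" for i
    using bij_betwE[OF f] that by auto
  moreover have "g j \<in> right_part G" if "j < n" for j
    using bij_betwE[OF g] that by auto
  ultimately show G: "bipartite_graph G"
    unfolding bipartite_graph_def E rect_def by auto
  have "inj_on (\<lambda>(j, i). (f i, g j)) (rect n m - A)"
    using fi gi by (auto simp: inj_on_def rect_def)
  then have "card (edges G) = m * n - card A"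
    unfolding E using card_Diff_subset[OF finite_subset[OF A fin] A] cardR by (simp add: card_image)
  then show "card A + card (edges G) = m * n"
    using card_mono[OF fin A] cardR by simp
  have key: "(card (row_nbrs m n (j, i) \<inter> A), card (col_nbrs m n (j, i) \<inter> A)) \<notin> Z \<longleftrightarrow>
      (card (edges G `` {f i}) - 1, card ((edges G)\<inverse> `` {g j}) - 1) \<in> family_diagram F"
    if v: "(j, i) \<in> rect n m - A" for i j
  proof -
    have ij: "j < n" "i < m" "(j, i) \<notin> A" using v by (auto simp: rect_def)
    \<comment> \<open>Since \<open>(j, i)\<close> is not in \<open>A\<close>, excluding it from its
      own row and column loses no element of \<open>A\<close>, so \<open>?J\<close> and
      \<open>?I\<close> count the neighbours in \<open>A\<close>.\<close>
    let ?J = "{j'. j' < n \<and> (j', i) \<in> A}" and ?I = "{i'. i' < m \<and> (j, i') \<in> A}"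
    have "row_nbrs m n (j, i) \<inter> A = (\<lambda>j'. (j', i)) ` ?J"
      using ij by (auto simp: row_nbrs_def rect_def)
    then have r: "card (row_nbrs m n (j, i) \<inter> A) = card ?J"
      by (simp add: card_image inj_on_def)
    have "col_nbrs m n (j, i) \<inter> A = (\<lambda>i'. (j, i')) ` ?I"
      using ij by (auto simp: col_nbrs_def rect_def)
    then have c: "card (col_nbrs m n (j, i) \<inter> A) = card ?I"
      by (simp add: card_image inj_on_def)
    have "edges G `` {f i} = g ` ({..<n} - ?J)"
      unfolding E using ij by (auto simp: rect_def fi image_iff)
    moreover have "inj_on g ({..<n} - ?J)"
      using g unfolding bij_betw_def by (auto intro: inj_on_subset)
    ultimately have "card (edges G `` {f i}) = card ({..<n} - ?J)" by (simp add: card_image)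
    also have "\<dots> = n - card ?J" by (subst card_Diff_subset) auto
    finally have d: "card (edges G `` {f i}) = n - card ?J" .
    have "(edges G)\<inverse> `` {g j} = f ` ({..<m} - ?I)"
      unfolding E using ij by (auto simp: rect_def gi image_iff)
    moreover have "inj_on f ({..<m} - ?I)"
      using f unfolding bij_betw_def by (auto intro: inj_on_subset)
    ultimately have "card ((edges G)\<inverse> `` {g j}) = card ({..<m} - ?I)" by (simp add: card_image)
    also have "\<dots> = m - card ?I" by (subst card_Diff_subset) auto
    finally have e: "card ((edges G)\<inverse> `` {g j}) = m - card ?I" .
    have "?J \<subset> {..<n}" "?I \<subset> {..<m}" using ij by auto
    then have lt: "card ?J < n" "card ?I < m"
      using psubset_card_mono[of "{..<n}" ?J] psubset_card_mono[of "{..<m}" ?I] by auto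
    \<comment> \<open>The reflected point is the pair of degrees minus one. As
      \<open>card ?J < n\<close> and \<open>card ?I < m\<close>, it lies in the rectangle and
      reflects exactly to the pair of neighbour counts.\<close>
    show ?thesis
      unfolding r c d e
      using mem_dual_iff[OF family_diagram_props(1)[OF F],
          of "n - card ?J - 1" n "m - card ?I - 1" m] lt
      by (simp add: dual)
  qed
  have "A \<union> {v \<in> rect n m - A. P v} = rect n m \<longleftrightarrow> (\<forall>v\<in>rect n m - A. P v)" for P
    using A by blast
  then have "growth Z m n A = rect n m \<longleftrightarrow> (\<forall>(j, i)\<in>rect n m - A.
      (card (row_nbrs m n (j, i) \<inter> A), card (col_nbrs m n (j, i) \<inter> A)) \<notin> Z)"
    unfolding growth_def by (simp add: split_def)
  also have "\<dots> \<longleftrightarrow> (\<forall>(x, y)\<in>edges G.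
      (card (edges G `` {x}) - 1, card ((edges G)\<inverse> `` {y}) - 1) \<in> family_diagram F)"
    (is "_ \<longleftrightarrow> (\<forall>(x, y)\<in>_. ?P x y)")
  proof -
    have "(\<forall>(x, y)\<in>edges G. ?P x y) \<longleftrightarrow> (\<forall>v\<in>rect n m - A. ?P (f (snd v)) (g (fst v)))"
      by (subst (1) E) (simp add: split_def)
    also have "\<dots> \<longleftrightarrow> (\<forall>(j, i)\<in>rect n m - A.
        (card (row_nbrs m n (j, i) \<inter> A), card (col_nbrs m n (j, i) \<inter> A)) \<notin> Z)"
      by (rule ball_cong[OF refl]) (use key[symmetric] in \<open>simp add: split_def\<close>)
    finally show ?thesis by (rule sym)
  qed
  finally show "growth Z m n A = rect n m \<longleftrightarrow> (\<forall>S\<in>F. \<not> contains_bigraph G S)"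
    unfolding avoids_family_iff[OF F G] .
qed

text \<open>Subtraction from \<open>N\<close> matches \<open>D\<close> with \<open>E\<close> and
  reverses the order. Both sets are bounded by \<open>N\<close>, so they are finite and the extrema
  are attained.\<close>

lemma Min_add_Max_complement:
  fixes D E :: "nat set"
  assumes "D \<noteq> {}" "\<And>d. d \<in> D \<Longrightarrow> \<exists>e\<in>E. d + e = N" "\<And>e. e \<in> E \<Longrightarrow> \<exists>d\<in>D. d + e = N"
  shows "Min D + Max E = N"
proof -
  have "D \<subseteq> {..N}" "E \<subseteq> {..N}" using assms(2,3) by fastforce+
  then have fin: "finite D" "finite E" using finite_subset by blast+
  obtain e where e: "e \<in> E" "Min D + e = N" using assms(2)[OF Min_in[OF fin(1) assms(1)]] by blast
  \<comment> \<open>A larger \<open>e'\<close> would be paired with an element of \<open>D\<close>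
    below the minimum.\<close>
  have "e' \<le> e" if "e' \<in> E" for e'
    using assms(3)[OF that] Min_le[OF fin(1)] e(2) by fastforce
  then have "Max E = e" using fin(2) e(1) by (intro Max_eqI) auto
  then show ?thesis using e(2) by simp
qed

theorem theorem3p1:
  fixes m n :: nat
    and Z :: "(nat \<times> nat) set"
    and F :: "(nat, nat) bigraph set"
  assumes "1 \<le> m" and "1 \<le> n"
    and "young_diagram Z"
    and "minimal_family F"
    and "Z \<subseteq> rect n m"
    and "family_diagram F \<subseteq> rect n m"
    and "Z = dual n m (family_diagram F)"
    and "family_diagram F = dual n m Z"
  shows "young_dom_number Z m n + bip_turan m n F = m * n"
  unfolding young_dom_number_def bip_turan_def
proof (rule Min_add_Max_complement)
  have "growth Z m n (rect n m) = rect n m" by (auto simp: growth_def)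
  then show "{card A |A. A \<subseteq> rect n m \<and> growth Z m n A = rect n m} \<noteq> {}" by blast
next
  fix d assume "d \<in> {card A |A. A \<subseteq> rect n m \<and> growth Z m n A = rect n m}"
  then obtain A where A: "d = card A" "A \<subseteq> rect n m" "growth Z m n A = rect n m" by blast
  \<comment> \<open>The coordinates themselves serve as vertex names, so both labellings are the
    identity.\<close>
  define G :: "(nat, nat) bigraph" where
    "G = \<lparr>left_part = {..<m}, right_part = {..<n},
          edges = (\<lambda>(j, i). (id i, id j)) ` (rect n m - A)\<rparr>"
  note corr = dominating_iff_avoids_family[OF assms(7,4), of id G id A]
  have "bipartite_graph G" "card A + card (edges G) = m * n" "\<forall>S\<in>F. \<not> contains_bigraph G S"
    using corr A by (simp_all add: G_def)
  moreover have "card (left_part G) = m" "card (right_part G) = n" by (simp_all add: G_def)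
  ultimately show "\<exists>e\<in>{card (edges G) |G :: (nat, nat) bigraph. bipartite_graph G \<and>
      card (left_part G) = m \<and> card (right_part G) = n \<and> (\<forall>S\<in>F. \<not> contains_bigraph G S)}.
      d + e = m * n"
    using A(1) by blast
next
  fix e assume "e \<in> {card (edges G) |G :: (nat, nat) bigraph. bipartite_graph G \<and>
      card (left_part G) = m \<and> card (right_part G) = n \<and> (\<forall>S\<in>F. \<not> contains_bigraph G S)}"
  then obtain G :: "(nat, nat) bigraph" where G: "e = card (edges G)" "bipartite_graph G"
    "card (left_part G) = m" "card (right_part G) = n" "\<forall>S\<in>F. \<not> contains_bigraph G S" by blast
  \<comment> \<open>The parts of \<open>G\<close> are arbitrary finite sets of naturals; numbering
    them carries the graph over to the rectangle.\<close>
  obtain f g where fg: "bij_betw f {..<m} (left_part G)" "bij_betw g {..<n} (right_part G)"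
    using ex_bij_betw_nat_finite[of "left_part G"] ex_bij_betw_nat_finite[of "right_part G"] G
    unfolding bipartite_graph_def atLeast0LessThan by blast
  define A where "A = {(j, i) \<in> rect n m. (f i, g j) \<notin> edges G}"
  have A: "A \<subseteq> rect n m" by (auto simp: A_def)
  \<comment> \<open>Surjectivity of the labellings: every edge comes from a cell of the rectangle,
    so none is missed by the complement of \<open>A\<close>.\<close>
  have "edges G \<subseteq> f ` {..<m} \<times> g ` {..<n}"
    using G(2) fg unfolding bipartite_graph_def bij_betw_def by simp
  then have "edges G = (\<lambda>(j, i). (f i, g j)) ` (rect n m - A)"
    unfolding A_def rect_def by (fastforce simp: image_iff)
  note corr = dominating_iff_avoids_family[OF assms(7,4) fg A this]
  show "\<exists>d\<in>{card A |A. A \<subseteq> rect n m \<and> growth Z m n A = rect n m}. d + e = m * n"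
    using corr(2,3) A G(1,5) by blast
qed

end
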